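(* Let $Y$ be a proper closed subspace of a Banach space $X$. If $Y$ is an M-ideal in $X$ and $Y$ has the SSD2P, then $X$ has the SSD2P.
   Context: All Banach spaces are nontrivial (i.e. $\neq\{0\}$) and over the real field. $B_X$ and $S_X$ denote the closed unit ball and unit sphere of $X$, and $X^*$ its dual. A slice of $B_X$ is a set $S(B_X,x^*,\alpha)=\{x\in B_X: x^*(x)>1-\alpha\}$ with $x^*\in S_{X^*}$ and $\alpha>0$. A Banach space $X$ has the symmetric strong diameter 2 property (SSD2P) if for every finite family $\{S_i\}_{i=1}^n$ of slices of $B_X$ and every $\varepsilon>0$ there exist $x_i\in S_i$ and $y\in B_X$, with $y$ independent of $i$, such that $x_i\pm y\in S_i$ for every $i\in\{1,\dots,n\}$ and $\|y\|>1-\varepsilon$. A subspace $Y$ of $X$ is an M-ideal in $X$ if there exists a bounded linear projection $P:X^*\to X^*$ such that $\ker P=Y^\perp=\{x^*\in X^*: x^*|_Y=0\}$ and $\|x^*\|=\|Px^*\|+\|x^*-Px^*\|$ for all $x^*\in X^*$. *)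

theory Defs
  imports "HOL-Analysis.Analysis"
begin

text \<open>
  Subspaces are carrier sets \<open>V\<close> in an ambient real normed space; the whole space is
  \<open>V = UNIV\<close>.  A functional on \<open>V\<close> is represented by a function on the ambient type of which only
  the values on \<open>V\<close> matter, so that \<open>V\<close> is treated as a normed space in its own right and no
  extension of its functionals to the ambient space is presupposed.
\<close>

definition dual_on :: "'a::real_normed_vector set \<Rightarrow> ('a \<Rightarrow> real) set" where
  "dual_on V = {f. (\<forall>x\<in>V. \<forall>y\<in>V. f (x + y) = f x + f y) \<and>
                   (\<forall>c. \<forall>x\<in>V. f (c *\<^sub>R x) = c * f x) \<and>
                   (\<exists>K. \<forall>x\<in>V. \<bar>f x\<bar> \<le> K * norm x)}"

definition unit_ball_on :: "'a::real_normed_vector set \<Rightarrow> 'a set" where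
  "unit_ball_on V = {x \<in> V. norm x \<le> 1}"

definition dual_norm_on :: "'a::real_normed_vector set \<Rightarrow> ('a \<Rightarrow> real) \<Rightarrow> real" where
  "dual_norm_on V f = (SUP x\<in>unit_ball_on V. \<bar>f x\<bar>)"

definition slice_on :: "'a::real_normed_vector set \<Rightarrow> ('a \<Rightarrow> real) \<Rightarrow> real \<Rightarrow> 'a set" where
  "slice_on V f \<alpha> = {x \<in> unit_ball_on V. f x > 1 - \<alpha>}"

definition is_slice_on :: "'a::real_normed_vector set \<Rightarrow> 'a set \<Rightarrow> bool" where
  "is_slice_on V S \<longleftrightarrow>
     (\<exists>f\<in>dual_on V. \<exists>\<alpha>>0. dual_norm_on V f = 1 \<and> S = slice_on V f \<alpha>)"

definition SSD2P_on :: "'a::real_normed_vector set \<Rightarrow> bool" where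
  "SSD2P_on V \<longleftrightarrow>
     (\<forall>(n::nat) (S :: nat \<Rightarrow> 'a set) \<epsilon>. (\<forall>i\<in>{1..n}. is_slice_on V (S i)) \<longrightarrow> \<epsilon> > 0 \<longrightarrow>
        (\<exists>(x :: nat \<Rightarrow> 'a) y. y \<in> unit_ball_on V \<and> norm y > 1 - \<epsilon> \<and>
           (\<forall>i\<in>{1..n}. x i \<in> S i \<and> x i + y \<in> S i \<and> x i - y \<in> S i)))"

definition annihilator :: "'a::real_normed_vector set \<Rightarrow> ('a \<Rightarrow>\<^sub>L real) set" where
  "annihilator Y = {f. \<forall>y\<in>Y. blinfun_apply f y = 0}"

definition M_ideal :: "'a::real_normed_vector set \<Rightarrow> bool" where
  "M_ideal Y \<longleftrightarrow> subspace Y \<and>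
     (\<exists>P :: ('a \<Rightarrow>\<^sub>L real) \<Rightarrow> ('a \<Rightarrow>\<^sub>L real).
        bounded_linear P \<and> (\<forall>f. P (P f) = P f) \<and>
        {f. P f = 0} = annihilator Y \<and>
        (\<forall>f. norm f = norm (P f) + norm (f - P f)))"

text \<open>On the whole space these notions agree with the dual and dual norm of the library.\<close>

lemma dual_on_UNIV: "dual_on UNIV = {f :: 'a::real_normed_vector \<Rightarrow> real. bounded_linear f}"
proof -
  have "f \<in> dual_on UNIV \<longleftrightarrow> bounded_linear f" for f :: "'a \<Rightarrow> real"
    unfolding dual_on_def bounded_linear_def bounded_linear_axioms_def linear_iff
    by (auto simp: mult.commute)
  then show ?thesis by blast
qed

lemma dual_norm_on_UNIV:
  fixes f :: "'a::real_normed_vector \<Rightarrow> real"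
  assumes f: "bounded_linear f"
  shows "dual_norm_on UNIV f = onorm f"
proof (rule antisym)
  have le: "\<bar>f x\<bar> \<le> onorm f" if "norm x \<le> 1" for x
  proof -
    have "\<bar>f x\<bar> \<le> onorm f * norm x" using onorm[OF f, of x] by simp
    also have "\<dots> \<le> onorm f" using that onorm_pos_le[OF f] by (simp add: mult_left_le)
    finally show ?thesis .
  qed
  have ne: "unit_ball_on (UNIV :: 'a set) \<noteq> {}"
    by (auto simp: unit_ball_on_def intro: exI[of _ 0])
  show "dual_norm_on UNIV f \<le> onorm f"
    unfolding dual_norm_on_def using ne le by (intro cSUP_least) (auto simp: unit_ball_on_def)
  have bdd: "bdd_above ((\<lambda>x. \<bar>f x\<bar>) ` unit_ball_on UNIV)"
    using le by (auto simp: bdd_above_def unit_ball_on_def)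
  show "onorm f \<le> dual_norm_on UNIV f"
    unfolding onorm_def
  proof (rule cSUP_least)
    fix x :: 'a
    have "norm (f x) / norm x = \<bar>f (x /\<^sub>R norm x)\<bar>"
      using f by (simp add: linear_simps(5) abs_mult divide_inverse mult.commute)
    also have "\<dots> \<le> dual_norm_on UNIV f"
      unfolding dual_norm_on_def by (rule cSUP_upper[OF _ bdd]) (cases "x = 0"; simp add: unit_ball_on_def)
    finally show "norm (f x) / norm x \<le> dual_norm_on UNIV f" .
  qed simp
qed

end

theory Submission imports Defs begin

text \<open>
  Let \<open>P\<close> be the projection of the M-ideal \<open>Y\<close>. Each functional \<open>f\<close> of norm one that defines
  a slice of the ball of \<open>X\<close> splits as \<open>P f + (f - P f)\<close>. The second part vanishes on \<open>Y\<close>;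
  the first agrees with \<open>f\<close> on \<open>Y\<close>, and its norm is at most that of the restriction of \<open>f\<close> to \<open>Y\<close>
  (\<open>M_ideal_norm_le_dual_norm_on\<close>). So the two norms, which add up to one, are almost attained
  separately: that of \<open>P f\<close> at points of the ball of \<open>Y\<close>, that of \<open>f - P f\<close> at some \<open>z\<close> in the ball of \<open>X\<close>.

  The symmetric strong diameter two property of \<open>Y\<close>, applied to slices on which the
  restrictions of the functionals are almost maximal, gives points \<open>x i\<close> and one long vector \<open>y\<close>
  with \<open>x i + y\<close> and \<open>x i - y\<close> in these slices. Adding \<open>z\<close> to both points supplies the
  missing value of \<open>f - P f\<close> but may spoil the norm and the value of \<open>P f\<close>. The M-ideal property repairs this: \<open>z\<close> can be changed by
  an element \<open>u\<close> of \<open>Y\<close> so that both sums have norm almost one while \<open>P f (z - u)\<close> is almost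
  zero (\<open>M_ideal_two_ball\<close>). A change by an element of \<open>Y\<close> does not affect
  \<open>f - P f\<close>, so \<open>f\<close> is almost one at \<open>x i + y + z - u\<close> and at \<open>x i - y + z - u\<close>
  (\<open>M_ideal_lift_to_slice\<close>). A slight rescaling moves these points into the given slices. The vector \<open>y\<close>
  is scaled by a factor independent of \<open>i\<close>, and the midpoints \<open>x i + z - u\<close>, rescaled, are in the slices by
  convexity.

  Both the bound for \<open>norm (P f)\<close> and the choice of \<open>u\<close> are applications of the Hahn--Banach
  theorem, which is proved here for a sublinear functional and a convex cone of
  upper bounds (\<open>hahn_banach_cone\<close>).
\<close>

section \<open>Sublinear functionals and the Hahn--Banach theorem\<close>

definition sublinear :: "('a::real_vector \<Rightarrow> real) \<Rightarrow> bool" where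
  "sublinear p \<longleftrightarrow>
     (\<forall>x y. p (x + y) \<le> p x + p y) \<and> (\<forall>r\<ge>0. \<forall>x. p (r *\<^sub>R x) \<le> r * p x)"

lemma sublinear_add: "sublinear p \<Longrightarrow> p (x + y) \<le> p x + p y"
  and sublinear_scale_le: "sublinear p \<Longrightarrow> r \<ge> 0 \<Longrightarrow> p (r *\<^sub>R x) \<le> r * p x"
  by (auto simp: sublinear_def)

lemma sublinear_0: "sublinear p \<Longrightarrow> p 0 = 0"
  using sublinear_add[of p 0 0] sublinear_scale_le[of p 0 0] by simp

lemma sublinear_scale:
  assumes p: "sublinear p" and r: "r \<ge> 0"
  shows "p (r *\<^sub>R x) = r * p x"
proof (cases "r = 0")
  case True
  then show ?thesis using sublinear_0[OF p] by simp
next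
  case False
  then have "r > 0" using r by simp
  have "p x \<le> inverse r * p (r *\<^sub>R x)"
    using sublinear_scale_le[OF p, of "inverse r" "r *\<^sub>R x"] \<open>r > 0\<close> by simp
  then have "r * p x \<le> p (r *\<^sub>R x)" using \<open>r > 0\<close> by (simp add: field_simps)
  then show ?thesis using sublinear_scale_le[OF p r, of x] by simp
qed

lemma sublinear_minus: "sublinear p \<Longrightarrow> - p (- x) \<le> p x"
  using sublinear_add[of p x "- x"] sublinear_0[of p] by simp

text \<open>
  A pair \<open>(l, s)\<close> in \<open>C\<close> stands for the demand that a functional be at most \<open>s\<close> at \<open>l\<close>, and
  \<open>cone_inf p C\<close> is the infimal convolution of \<open>p\<close> with the lower envelope of \<open>C\<close>. For a convex
  cone \<open>C\<close> of demands each compatible with \<open>p\<close>, the linear functionals below \<open>p\<close> that meet all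
  of them are exactly the linear functionals below \<open>cone_inf p C\<close>.
\<close>

definition cone_inf :: "('a::real_vector \<Rightarrow> real) \<Rightarrow> ('a \<times> real) set \<Rightarrow> 'a \<Rightarrow> real" where
  "cone_inf p C x = (INF (l, s)\<in>C. s + p (x - l))"

text \<open>
  The compatibility condition \<open>0 \<le> s + p (- l)\<close> bounds the infimum from below by \<open>- p (- x)\<close>,
  so that it is a genuine one.
\<close>

lemma cone_inf_le:
  assumes p: "sublinear p" and C: "\<And>l s. (l, s) \<in> C \<Longrightarrow> 0 \<le> s + p (- l)"
    and ls: "(l, s) \<in> C"
  shows "cone_inf p C x \<le> s + p (x - l)"
proof -
  have "- p (- x) \<le> s' + p (x - l')" if "(l', s') \<in> C" for l' s'
    using C[OF that] sublinear_add[OF p, of "x - l'" "- x"] by simp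
  then have "bdd_below ((\<lambda>(l, s). s + p (x - l)) ` C)"
    by (intro bdd_belowI2[of _ "- p (- x)"]) auto
  from cINF_lower[OF this ls] show ?thesis by (simp add: cone_inf_def)
qed

lemma cone_inf_sublinear:
  assumes p: "sublinear p" and cone: "convex_cone C"
    and C: "\<And>l s. (l, s) \<in> C \<Longrightarrow> 0 \<le> s + p (- l)"
  shows "sublinear (cone_inf p C)"
    and "cone_inf p C x \<le> p x"
    and "(l, s) \<in> C \<Longrightarrow> cone_inf p C l \<le> s"
proof -
  have le: "cone_inf p C x \<le> s + p (x - l)" if "(l, s) \<in> C" for l s x
    using C that by (rule cone_inf_le[OF p])
  have zero: "(0, 0) \<in> C" using convex_cone_contains_0[OF cone] by (simp add: zero_prod_def)
  have ge: "b \<le> cone_inf p C x" if "\<And>l s. (l, s) \<in> C \<Longrightarrow> b \<le> s + p (x - l)" for b x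
    unfolding cone_inf_def using that zero by (intro cINF_greatest) auto
  show "cone_inf p C x \<le> p x" using le[OF zero, of x] by simp
  show "cone_inf p C l \<le> s" if "(l, s) \<in> C" using le[OF that, of l] sublinear_0[OF p] by simp
  show "sublinear (cone_inf p C)"
    unfolding sublinear_def
  proof (intro conjI allI impI)
    fix x y
    have "cone_inf p C (x + y) - (s + p (x - l)) \<le> s' + p (y - l')"
      if "(l, s) \<in> C" "(l', s') \<in> C" for l s l' s'
    proof -
      have "(l + l', s + s') \<in> C" using convex_cone_add[OF cone that] by simp
      from le[OF this, of "x + y"]
      have "cone_inf p C (x + y) \<le> s + s' + p ((x - l) + (y - l'))" by (simp add: algebra_simps)
      then show ?thesis using sublinear_add[OF p, of "x - l" "y - l'"] by simp
    qed
    then have "cone_inf p C (x + y) - (s + p (x - l)) \<le> cone_inf p C y" if "(l, s) \<in> C" for l s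
      using ge that by blast
    then have "cone_inf p C (x + y) - cone_inf p C y \<le> cone_inf p C x"
      by (intro ge) (smt (verit))
    then show "cone_inf p C (x + y) \<le> cone_inf p C x + cone_inf p C y" by simp
  next
    fix r :: real and x assume r: "r \<ge> 0"
    have scaled: "cone_inf p C (r *\<^sub>R x) \<le> r * (s + p (x - l))" if "(l, s) \<in> C" for l s
    proof -
      have "(r *\<^sub>R l, r * s) \<in> C" using convex_cone_scaleR[OF cone r that] by simp
      from le[OF this, of "r *\<^sub>R x"]
      have "cone_inf p C (r *\<^sub>R x) \<le> r * s + p (r *\<^sub>R (x - l))" by (simp add: algebra_simps)
      then show ?thesis using sublinear_scale[OF p r, of "x - l"] by (simp add: distrib_left)
    qed
    show "cone_inf p C (r *\<^sub>R x) \<le> r * cone_inf p C x"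
    proof (cases "r = 0")
      case True
      then show ?thesis using scaled[OF zero] by simp
    next
      case False
      then have "r > 0" using r by simp
      have "cone_inf p C (r *\<^sub>R x) / r \<le> cone_inf p C x"
        using scaled \<open>r > 0\<close> by (intro ge) (simp add: field_simps)
      then show ?thesis using \<open>r > 0\<close> by (simp add: field_simps)
    qed
  qed
qed

lemma convex_cone_ray: "convex_cone ((\<lambda>t. t *\<^sub>R v) ` {0..})"
  unfolding convex_cone_iff
proof (intro conjI ballI allI impI)
  show "0 \<in> (\<lambda>t. t *\<^sub>R v) ` {0..}" by (rule image_eqI[of _ _ 0]) auto
next
  fix x y assume "x \<in> (\<lambda>t. t *\<^sub>R v) ` {0..}" "y \<in> (\<lambda>t. t *\<^sub>R v) ` {0..}"
  then obtain t t' where "t \<ge> 0" "t' \<ge> 0" "x = t *\<^sub>R v" "y = t' *\<^sub>R v" by auto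
  then show "x + y \<in> (\<lambda>t. t *\<^sub>R v) ` {0..}"
    by (intro image_eqI[of _ _ "t + t'"]) (auto simp: scaleR_add_left)
next
  fix x and r :: real assume "x \<in> (\<lambda>t. t *\<^sub>R v) ` {0..}" "r \<ge> 0"
  then obtain t where "t \<ge> 0" "x = t *\<^sub>R v" by auto
  then show "r *\<^sub>R x \<in> (\<lambda>t. t *\<^sub>R v) ` {0..}"
    using \<open>r \<ge> 0\<close> by (intro image_eqI[of _ _ "r * t"]) auto
qed

text \<open>
  For a fixed \<open>a\<close>, demanding at most \<open>- m a\<close> at \<open>- a\<close> gives a sublinear functional below \<open>m\<close>.
  By minimality it equals \<open>m\<close>, and this yields \<open>m x \<le> m (x + a) - m a\<close>, the inequality
  that a sublinear functional lacks for being additive.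
\<close>

lemma minimal_sublinear_linear:
  assumes m: "sublinear m" and min: "\<And>q. sublinear q \<Longrightarrow> (\<forall>x. q x \<le> m x) \<Longrightarrow> q = m"
  shows "linear m"
proof -
  have add: "m (x + a) = m x + m a" for x a
  proof -
    define C where "C = (\<lambda>t::real. t *\<^sub>R (- a, - m a)) ` {0..}"
    have cone: "convex_cone C" unfolding C_def by (rule convex_cone_ray)
    have ge: "0 \<le> s + m (- l)" if "(l, s) \<in> C" for l s
      using that sublinear_scale[OF m] by (auto simp: C_def)
    have "cone_inf m C = m"
      using cone_inf_sublinear(1,2)[OF m cone ge] by (intro min) auto
    moreover have "(- a, - m a) \<in> C" unfolding C_def by (rule image_eqI[of _ _ 1]) auto
    ultimately have "m x \<le> - m a + m (x - - a)" using cone_inf_le[OF m ge] by metis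
    then show ?thesis using sublinear_add[OF m, of x a] by simp
  qed
  have "m (- x) = - m x" for x using add[of x "- x"] sublinear_0[OF m] by simp
  then have "m (r *\<^sub>R x) = r * m x" for r x
    using sublinear_scale[OF m, of r x] sublinear_scale[OF m, of "- r" "- x"]
    by (cases "r \<ge> 0") auto
  then show ?thesis using add by (intro linearI) auto
qed

text \<open>
  Zorn's lemma gives a minimal sublinear functional below \<open>p\<close>. The pointwise infimum of
  a chain is finite, since every sublinear \<open>q \<le> p\<close> satisfies \<open>- p (- x) \<le> q x\<close>, and it is
  subadditive because two members of a chain can be replaced by the smaller one.
\<close>

lemma ex_linear_below_sublinear:
  fixes p :: "'a::real_vector \<Rightarrow> real"
  assumes p: "sublinear p"
  shows "\<exists>F. linear F \<and> (\<forall>x. F x \<le> p x)"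
proof -
  define A where "A = {q. sublinear q \<and> (\<forall>x. q x \<le> p x)}"
  have pA: "p \<in> A" using p by (auto simp: A_def)
  have "\<exists>m\<in>A. \<forall>q\<in>A. (\<forall>x. q x \<le> m x) \<longrightarrow> q = m"
  proof (rule predicate_Zorn)
    show "partial_order_on A (relation_of (\<lambda>m q. \<forall>x. q x \<le> m x) A)"
      by (rule partial_order_on_relation_ofI) (auto intro: order_trans intro!: ext order_antisym)
  next
    fix K assume K: "K \<in> Chains (relation_of (\<lambda>m q :: 'a \<Rightarrow> real. \<forall>x. q x \<le> m x) A)"
    then have KA: "K \<subseteq> A"
      and tot: "\<And>m q. m \<in> K \<Longrightarrow> q \<in> K \<Longrightarrow> (\<forall>x. q x \<le> m x) \<or> (\<forall>x. m x \<le> q x)"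
      by (auto simp: Chains_def relation_of_def)
    show "\<exists>u\<in>A. \<forall>q\<in>K. \<forall>x. u x \<le> q x"
    proof (cases "K = {}")
      case True
      then show ?thesis using pA by auto
    next
      case False
      define u where "u x = (INF q\<in>K. q x)" for x
      have "- p (- x) \<le> q x" if "q \<in> K" for q x
        using that KA sublinear_minus[of q x] unfolding A_def by (smt (verit) mem_Collect_eq subsetD)
      then have bdd: "bdd_below ((\<lambda>q. q x) ` K)" for x by (intro bdd_belowI2) auto
      have le: "u x \<le> q x" if "q \<in> K" for q x
        unfolding u_def using cINF_lower[OF bdd that] by simp
      have ge: "b \<le> u x" if "\<And>q. q \<in> K \<Longrightarrow> b \<le> q x" for b x
        unfolding u_def using that False by (intro cINF_greatest) auto
      have "sublinear u"
        unfolding sublinear_def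
      proof (intro conjI allI impI)
        fix x y
        have "u (x + y) - q x \<le> q' y" if q: "q \<in> K" "q' \<in> K" for q q'
        proof -
          obtain m where m: "m \<in> K" "m x \<le> q x" "m y \<le> q' y"
            using tot[OF q] q by auto
          then have "u (x + y) \<le> m x + m y"
            using le[OF m(1), of "x + y"] KA sublinear_add[of m x y] by (auto simp: A_def)
          then show ?thesis using m by simp
        qed
        then have "u (x + y) - q x \<le> u y" if "q \<in> K" for q using ge that by blast
        then have "u (x + y) - u y \<le> u x" by (intro ge) (smt (verit))
        then show "u (x + y) \<le> u x + u y" by simp
      next
        fix r :: real and x assume r: "r \<ge> 0"
        have scaled: "u (r *\<^sub>R x) \<le> r * q x" if "q \<in> K" for q
          using le[OF that, of "r *\<^sub>R x"] KA that sublinear_scale[of q r x] r by (auto simp: A_def)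
        show "u (r *\<^sub>R x) \<le> r * u x"
        proof (cases "r = 0")
          case True
          then show ?thesis using scaled False by auto
        next
          case False
          then have "r > 0" using r by simp
          have "u (r *\<^sub>R x) / r \<le> u x"
            using scaled \<open>r > 0\<close> by (intro ge) (simp add: field_simps)
          then show ?thesis using \<open>r > 0\<close> by (simp add: field_simps)
        qed
      qed
      moreover have "u x \<le> p x" for x
        using False le KA unfolding A_def by (smt (verit) all_not_in_conv mem_Collect_eq subsetD)
      ultimately show ?thesis using le by (auto simp: A_def)
    qed
  qed
  then obtain m where "m \<in> A" and min: "\<And>q. q \<in> A \<Longrightarrow> (\<forall>x. q x \<le> m x) \<Longrightarrow> q = m" by blast
  then have m: "sublinear m" "\<And>x. m x \<le> p x" by (auto simp: A_def)
  have "linear m"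
    using m(1)
  proof (rule minimal_sublinear_linear)
    fix q assume "sublinear q" "\<forall>x. q x \<le> m x"
    then show "q = m" using m by (intro min) (auto simp: A_def intro: order_trans)
  qed
  with m show ?thesis by blast
qed

text \<open>
  A linear functional below \<open>p\<close> can be subjected to any convex cone of upper bounds, as
  long as no single bound contradicts \<open>p\<close>. With the graph of a functional on a subspace as
  the cone this is the extension theorem; with a cone of bounds on a subspace and a
  ray it separates a point from the subspace.
\<close>

theorem hahn_banach_cone:
  fixes p :: "'a::real_vector \<Rightarrow> real"
  assumes p: "sublinear p" and cone: "convex_cone C"
    and C: "\<And>l s. (l, s) \<in> C \<Longrightarrow> 0 \<le> s + p (- l)"
  obtains F where "linear F" "\<And>x. F x \<le> p x" "\<And>l s. (l, s) \<in> C \<Longrightarrow> F l \<le> s"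
proof -
  note q = cone_inf_sublinear[OF p cone C]
  obtain F where "linear F" "\<And>x. F x \<le> cone_inf p C x"
    using ex_linear_below_sublinear[OF q(1)] by blast
  then show ?thesis using q(2,3) order_trans by (intro that[of F]) blast+
qed

text \<open>
  If \<open>a\<close> has distance at least \<open>d\<close> from \<open>L\<close>, measured by \<open>p\<close>, then some functional
  below \<open>p\<close> sees this distance. The demands are \<open>F l \<le> 0\<close> on \<open>L\<close>, which force \<open>F = 0\<close> there, and
  \<open>F (- a) \<le> - d\<close>.
\<close>

lemma hahn_banach_distance:
  fixes p :: "'a::real_vector \<Rightarrow> real"
  assumes p: "sublinear p" and nonneg: "\<And>x. 0 \<le> p x" and L: "subspace L"
    and d: "\<And>l. l \<in> L \<Longrightarrow> d \<le> p (a - l)"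
  obtains F where "linear F" "\<And>x. F x \<le> p x" "\<And>l. l \<in> L \<Longrightarrow> F l = 0" "d \<le> F a"
proof -
  \<comment> \<open>the cone generated by the bounds \<open>(l, 0)\<close> with \<open>l\<close> in \<open>L\<close>, and \<open>(- a, - d)\<close>\<close>
  define C where "C = {(l - r *\<^sub>R a, - (r * d)) | l r. l \<in> L \<and> r \<ge> 0}"
  have "convex_cone C"
    unfolding convex_cone_iff
  proof (intro conjI ballI allI impI)
    show "0 \<in> C"
      unfolding C_def using subspace_0[OF L]
      by (auto simp: zero_prod_def intro!: exI[of _ 0])
  next
    fix u v assume "u \<in> C" "v \<in> C"
    then obtain l r l' r' where "l \<in> L" "r \<ge> 0" "u = (l - r *\<^sub>R a, - (r * d))"
      and "l' \<in> L" "r' \<ge> 0" "v = (l' - r' *\<^sub>R a, - (r' * d))"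
      unfolding C_def by blast
    then show "u + v \<in> C"
      unfolding C_def using subspace_add[OF L]
      by (auto simp: algebra_simps intro!: exI[of _ "l + l'"] exI[of _ "r + r'"])
  next
    fix u :: "'a \<times> real" and c :: real assume "u \<in> C" "c \<ge> 0"
    then obtain l r where "l \<in> L" "r \<ge> 0" "u = (l - r *\<^sub>R a, - (r * d))"
      unfolding C_def by blast
    then show "c *\<^sub>R u \<in> C"
      unfolding C_def using subspace_scale[OF L] \<open>c \<ge> 0\<close>
      by (auto simp: algebra_simps intro!: exI[of _ "c *\<^sub>R l"] exI[of _ "c * r"])
  qed
  moreover have "0 \<le> s + p (- m)" if ms: "(m, s) \<in> C" for m s
  proof -
    obtain l r where l: "l \<in> L" and r: "r \<ge> 0" and m: "m = l - r *\<^sub>R a" and s: "s = - (r * d)"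
      using ms unfolding C_def by blast
    show ?thesis
    proof (cases "r = 0")
      case True
      then show ?thesis using s nonneg by simp
    next
      case False
      then have "- m = r *\<^sub>R (a - inverse r *\<^sub>R l)" by (simp add: m algebra_simps)
      then have "p (- m) = r * p (a - inverse r *\<^sub>R l)" using sublinear_scale[OF p r] by simp
      moreover have "r * d \<le> r * p (a - inverse r *\<^sub>R l)"
        using d[OF subspace_scale[OF L l]] r by (rule mult_left_mono)
      ultimately show ?thesis using s by simp
    qed
  qed
  ultimately obtain F where F: "linear F" "\<And>x. F x \<le> p x" "\<And>l s. (l, s) \<in> C \<Longrightarrow> F l \<le> s"
    using hahn_banach_cone[OF p] by blast
  have le0: "F l \<le> 0" if "l \<in> L" for l
  proof -
    have "(l - 0 *\<^sub>R a, - (0 * d)) \<in> C" using that unfolding C_def by blast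
    from F(3)[OF this] show ?thesis by simp
  qed
  have "F l = 0" if "l \<in> L" for l
    using le0[OF that] le0[OF subspace_neg[OF L that]] linear_neg[OF F(1), of l] by simp
  moreover have "(0 - 1 *\<^sub>R a, - (1 * d)) \<in> C"
    using subspace_0[OF L] zero_le_one unfolding C_def by blast
  then have "F (- a) \<le> - d" using F(3) by fastforce
  ultimately show ?thesis using F(1,2) linear_neg[OF F(1), of a] by (intro that[of F]) auto
qed

section \<open>The dual of a subspace\<close>

lemma dual_norm_on_upper:
  assumes f: "f \<in> dual_on V" and x: "x \<in> V" "norm x \<le> 1"
  shows "\<bar>f x\<bar> \<le> dual_norm_on V f"
proof -
  obtain K where K: "\<And>x. x \<in> V \<Longrightarrow> \<bar>f x\<bar> \<le> K * norm x" using f unfolding dual_on_def by blast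
  have "\<bar>f u\<bar> \<le> \<bar>K\<bar>" if u: "u \<in> V" "norm u \<le> 1" for u
  proof -
    have "\<bar>f u\<bar> \<le> \<bar>K\<bar> * norm u"
      using K[OF u(1)] mult_right_mono[OF abs_ge_self norm_ge_zero] by (rule order_trans)
    also have "\<dots> \<le> \<bar>K\<bar>" using u by (simp add: mult_left_le)
    finally show ?thesis .
  qed
  then have "bdd_above ((\<lambda>x. \<bar>f x\<bar>) ` unit_ball_on V)"
    by (auto simp: bdd_above_def unit_ball_on_def)
  then show ?thesis
    unfolding dual_norm_on_def by (intro cSUP_upper) (simp_all add: unit_ball_on_def x)
qed

lemma abs_le_dual_norm_on:
  assumes V: "subspace V" and f: "f \<in> dual_on V" and x: "x \<in> V"
  shows "\<bar>f x\<bar> \<le> dual_norm_on V f * norm x"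
proof (cases "x = 0")
  case True
  then show ?thesis using f x by (auto simp: dual_on_def dest: spec[of _ 0])
next
  case False
  have "\<bar>f (inverse (norm x) *\<^sub>R x)\<bar> \<le> dual_norm_on V f"
    using False by (intro dual_norm_on_upper[OF f] subspace_scale[OF V x]) simp
  moreover have "f (inverse (norm x) *\<^sub>R x) = inverse (norm x) * f x"
    using f x by (simp add: dual_on_def)
  ultimately have "inverse (norm x) * \<bar>f x\<bar> \<le> dual_norm_on V f" by (simp add: abs_mult)
  then show ?thesis using False by (simp add: field_simps)
qed

lemma dual_norm_on_least:
  assumes "0 \<in> V" and "\<And>x. x \<in> V \<Longrightarrow> norm x \<le> 1 \<Longrightarrow> \<bar>f x\<bar> \<le> b"
  shows "dual_norm_on V f \<le> b"
  unfolding dual_norm_on_def using assms by (intro cSUP_least) (auto simp: unit_ball_on_def)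

lemma dual_norm_on_nonneg:
  assumes "subspace V" and "f \<in> dual_on V"
  shows "0 \<le> dual_norm_on V f"
  using dual_norm_on_upper[OF assms(2) subspace_0[OF assms(1)]] by simp

lemma dual_on_scale: "f \<in> dual_on V \<Longrightarrow> (\<lambda>x. c * f x) \<in> dual_on V"
proof -
  assume f: "f \<in> dual_on V"
  then obtain K where K: "\<And>x. x \<in> V \<Longrightarrow> \<bar>f x\<bar> \<le> K * norm x" unfolding dual_on_def by blast
  have "\<bar>c * f x\<bar> \<le> (\<bar>c\<bar> * K) * norm x" if "x \<in> V" for x
    using mult_left_mono[OF K[OF that], of "\<bar>c\<bar>"] by (simp add: abs_mult mult.assoc)
  then show ?thesis using f by (auto simp: dual_on_def algebra_simps intro!: exI[of _ "\<bar>c\<bar> * K"])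
qed

lemma dual_norm_on_normalize:
  assumes V: "subspace V" and f: "f \<in> dual_on V" and pos: "0 < dual_norm_on V f"
  shows "dual_norm_on V (\<lambda>x. f x / dual_norm_on V f) = 1"
proof (rule antisym)
  let ?a = "dual_norm_on V f" and ?g = "\<lambda>x. f x / dual_norm_on V f"
  have g: "?g \<in> dual_on V" using dual_on_scale[OF f, of "inverse ?a"] by (simp add: field_simps)
  show "dual_norm_on V ?g \<le> 1"
    using dual_norm_on_upper[OF f] pos subspace_0[OF V] by (intro dual_norm_on_least) auto
  have "?a \<le> dual_norm_on V ?g * ?a"
    using dual_norm_on_upper[OF g] pos subspace_0[OF V]
    by (intro dual_norm_on_least) (auto simp: field_simps)
  then show "1 \<le> dual_norm_on V ?g" using pos by simp
qed

lemma blinfun_in_dual_on: "blinfun_apply f \<in> dual_on V"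
  unfolding dual_on_def
  by (auto simp: blinfun.bilinear_simps intro!: exI[of _ "norm f"] norm_blinfun[of f, simplified])

lemma ex_blinfun_of_linear_le:
  fixes F :: "'a::real_normed_vector \<Rightarrow> real"
  assumes F: "linear F" and K: "K \<ge> 0" "\<And>x. F x \<le> K * norm x"
  obtains g :: "'a \<Rightarrow>\<^sub>L real" where "blinfun_apply g = F" "norm g \<le> K"
proof -
  have abs: "\<bar>F x\<bar> \<le> K * norm x" for x
    using K(2)[of x] K(2)[of "- x"] linear_neg[OF F, of x] by auto
  then have bl: "bounded_linear F"
    using F by (intro bounded_linear_intro[of F K]) (auto simp: linear_add linear_scale mult.commute)
  have "norm (Blinfun F) \<le> K"
    using abs K(1) by (intro norm_blinfun_bound) (auto simp: bounded_linear_Blinfun_apply[OF bl])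
  with bounded_linear_Blinfun_apply[OF bl] show ?thesis by (rule that)
qed

lemma norm_preserving_extension:
  fixes V :: "'a::real_normed_vector set"
  assumes V: "subspace V" and f: "f \<in> dual_on V"
  obtains g :: "'a \<Rightarrow>\<^sub>L real" where "norm g \<le> dual_norm_on V f" "\<And>x. x \<in> V \<Longrightarrow> g x = f x"
proof -
  let ?K = "dual_norm_on V f"
  define C where "C = (\<lambda>x. (x, f x)) ` V"
  have K: "0 \<le> ?K" by (rule dual_norm_on_nonneg[OF V f])
  have add: "f (x + y) = f x + f y" if "x \<in> V" "y \<in> V" for x y using f that by (auto simp: dual_on_def)
  have scale: "f (c *\<^sub>R x) = c * f x" if "x \<in> V" for c x using f that by (auto simp: dual_on_def)
  have p: "sublinear (\<lambda>x. ?K * norm x)"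
    unfolding sublinear_def
    using K mult_left_mono[OF norm_triangle_ineq K] by (auto simp: distrib_left)
  have cone: "convex_cone C"
    unfolding convex_cone_iff C_def
    using V add scale scale[of 0 0]
    by (auto simp: subspace_def zero_prod_def image_iff)
  have C: "0 \<le> s + ?K * norm (- l)" if "(l, s) \<in> C" for l s
    using that abs_le_dual_norm_on[OF V f, of l] by (auto simp: C_def)
  obtain F where F: "linear F" "\<And>x. F x \<le> ?K * norm x" "\<And>l s. (l, s) \<in> C \<Longrightarrow> F l \<le> s"
    using hahn_banach_cone[OF p cone C] by blast
  have le: "F x \<le> f x" if "x \<in> V" for x using that by (intro F(3)) (auto simp: C_def)
  have eq: "F x = f x" if "x \<in> V" for x
    using le[OF that] le[OF subspace_neg[OF V that]] linear_neg[OF F(1), of x] scale[OF that, of "-1"]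
    by simp
  obtain g :: "'a \<Rightarrow>\<^sub>L real" where "blinfun_apply g = F" "norm g \<le> ?K"
    by (rule ex_blinfun_of_linear_le[OF F(1) K F(2)])
  then show ?thesis using eq by (intro that[of g]) auto
qed

text \<open>
  Slices of the ball of \<open>V\<close> exist only if \<open>V\<close> carries a nonzero functional; separating a nonzero
  vector from the subspace \<open>{0}\<close> provides one.
\<close>

lemma ex_norm_one_dual_on:
  fixes V :: "'a::real_normed_vector set"
  assumes V: "subspace V" "V \<noteq> {0}"
  obtains f where "f \<in> dual_on V" "dual_norm_on V f = 1"
proof -
  obtain a where a: "a \<in> V" "a \<noteq> 0" using V subspace_0[OF V(1)] by blast
  have "sublinear (norm :: 'a \<Rightarrow> real)" by (simp add: sublinear_def norm_triangle_ineq)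
  then obtain F where F: "linear F" "\<And>x. F x \<le> norm x" "norm a \<le> F a"
    by (rule hahn_banach_distance[of norm "{0}" "norm a" a]) (auto simp: subspace_0)
  obtain g :: "'a \<Rightarrow>\<^sub>L real" where g: "blinfun_apply g = F" "norm g \<le> 1"
    using ex_blinfun_of_linear_le[OF F(1), of 1] F(2) by auto
  have "norm a \<le> dual_norm_on V g * norm a"
    using abs_le_dual_norm_on[OF V(1) blinfun_in_dual_on a(1), of g] F(3) g(1) by simp
  then have "0 < dual_norm_on V g" using a(2) by (smt (verit) mult_nonpos_nonneg zero_less_norm_iff)
  from dual_norm_on_normalize[OF V(1) blinfun_in_dual_on this]
    dual_on_scale[OF blinfun_in_dual_on, of "inverse (dual_norm_on V g)" g V]
  show ?thesis by (intro that[of "\<lambda>x. g x / dual_norm_on V g"]) (auto simp: field_simps)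
qed

text \<open>
  If \<open>f\<close> does not vanish on \<open>V\<close>, the slice is cut out by the normalization of \<open>f\<close>. If \<open>f\<close> vanishes
  on \<open>V\<close>, the lower bound is trivial and every slice will do; this case occurs because a functional
  of norm one on the whole space may well annihilate the subspace.
\<close>

lemma ex_slice_on_near_dual_norm:
  assumes V: "subspace V" "V \<noteq> {0}" and f: "f \<in> dual_on V" and \<delta>: "\<delta> > 0"
  obtains T where "is_slice_on V T" "T \<subseteq> unit_ball_on V"
    "\<And>w. w \<in> T \<Longrightarrow> f w \<ge> dual_norm_on V f - \<delta>"
proof (cases "dual_norm_on V f = 0")
  case True
  obtain g where g: "g \<in> dual_on V" "dual_norm_on V g = 1" by (rule ex_norm_one_dual_on[OF V])
  show ?thesis
  proof (rule that)
    show "is_slice_on V (slice_on V g 1)"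
      unfolding is_slice_on_def using g by (intro bexI[of _ g] exI[of _ 1]) auto
    fix w assume "w \<in> slice_on V g 1"
    then have "\<bar>f w\<bar> \<le> 0"
      using dual_norm_on_upper[OF f, of w] True by (simp add: slice_on_def unit_ball_on_def)
    then show "f w \<ge> dual_norm_on V f - \<delta>" using True \<delta> by simp
  qed (simp add: slice_on_def subset_iff)
next
  case False
  let ?a = "dual_norm_on V f"
  have a: "0 < ?a" using False dual_norm_on_nonneg[OF V(1) f] by simp
  let ?g = "\<lambda>x. f x / ?a"
  have g: "?g \<in> dual_on V" using dual_on_scale[OF f, of "inverse ?a"] by (simp add: field_simps)
  show ?thesis
  proof (rule that)
    show "is_slice_on V (slice_on V ?g (\<delta> / ?a))"
      unfolding is_slice_on_def using g dual_norm_on_normalize[OF V(1) f a] a \<delta>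
      by (intro bexI[of _ ?g] exI[of _ "\<delta> / ?a"]) auto
    fix w assume "w \<in> slice_on V ?g (\<delta> / ?a)"
    then have "1 - \<delta> / ?a < f w / ?a" by (simp add: slice_on_def)
    from mult_strict_right_mono[OF this a] have "?a - \<delta> < f w" using a by (simp add: left_diff_distrib)
    then show "f w \<ge> ?a - \<delta>" by simp
  qed (simp add: slice_on_def subset_iff)
qed

lemma midpoint_in_slice_on:
  assumes V: "subspace V" and f: "f \<in> dual_on V"
    and "x + y \<in> slice_on V f \<alpha>" "x - y \<in> slice_on V f \<alpha>"
  shows "x \<in> slice_on V f \<alpha>"
proof -
  let ?a = "x + y" and ?b = "x - y"
  have in_V: "?a \<in> V" "?b \<in> V" and ball: "norm ?a \<le> 1" "norm ?b \<le> 1"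
    and val: "f ?a > 1 - \<alpha>" "f ?b > 1 - \<alpha>"
    using assms(3,4) by (auto simp: slice_on_def unit_ball_on_def)
  have x: "x = (1/2) *\<^sub>R (?a + ?b)" by (simp flip: scaleR_2)
  have "x \<in> V" by (subst x) (intro subspace_scale[OF V] subspace_add[OF V] in_V)
  have two: "?a + ?b = 2 *\<^sub>R x" by (simp add: scaleR_2)
  have "2 * norm x = norm (?a + ?b)" unfolding two by simp
  then have "norm x \<le> 1" using norm_triangle_ineq[of ?a ?b] ball by linarith
  moreover have "2 * f x = f ?a + f ?b"
  proof -
    have "2 * f x = f (2 *\<^sub>R x)" using f \<open>x \<in> V\<close> by (simp add: dual_on_def)
    also have "\<dots> = f (?a + ?b)" by (simp only: two)
    also have "\<dots> = f ?a + f ?b" using f in_V unfolding dual_on_def by blast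
    finally show ?thesis .
  qed
  ultimately show ?thesis using \<open>x \<in> V\<close> val by (simp add: slice_on_def unit_ball_on_def)
qed

section \<open>M-ideals\<close>

text \<open>
  Let \<open>g\<close> extend the restriction of \<open>f\<close> to \<open>Y\<close> without increase of norm. Then \<open>g - f\<close> is in the
  annihilator, which is the kernel of \<open>P\<close>, so \<open>P f = P g\<close> and \<open>norm (P g) \<le> norm g\<close>.
\<close>

lemma M_ideal_norm_le_dual_norm_on:
  fixes P :: "('a::real_normed_vector \<Rightarrow>\<^sub>L real) \<Rightarrow> 'a \<Rightarrow>\<^sub>L real"
  assumes Y: "subspace Y" and P: "linear P" "{f. P f = 0} = annihilator Y"
    and norm: "\<And>f. norm f = norm (P f) + norm (f - P f)"
  shows "norm (P f) \<le> dual_norm_on Y f"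
proof -
  obtain g :: "'a \<Rightarrow>\<^sub>L real" where g: "norm g \<le> dual_norm_on Y f" "\<And>x. x \<in> Y \<Longrightarrow> g x = f x"
    using norm_preserving_extension[OF Y blinfun_in_dual_on, of f] by blast
  have "g - f \<in> annihilator Y" using g(2) by (simp add: annihilator_def blinfun.diff_left)
  then have "P (g - f) = 0" using P(2) by blast
  then have "P g = P f" using linear_diff[OF P(1)] by simp
  then have "norm (P f) \<le> norm g" using norm[of g] by simp
  then show ?thesis using g(1) by (rule order_trans)
qed

text \<open>
  The dual of a maximum norm is a sum norm: \<open>x\<close> and \<open>y\<close> can approach the norms of \<open>g\<close> and \<open>h\<close>
  independently.
\<close>

lemma norm_add_le_if_separate_le:
  fixes g h :: "'a::real_normed_vector \<Rightarrow>\<^sub>L real"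
  assumes le: "\<And>x y. norm x \<le> 1 \<Longrightarrow> norm y \<le> 1 \<Longrightarrow> g x + h y \<le> c"
  shows "norm g + norm h \<le> c"
proof -
  have bound: "norm k \<le> b" if k: "\<And>x. norm x \<le> 1 \<Longrightarrow> k x \<le> b" for k :: "'a \<Rightarrow>\<^sub>L real" and b
  proof (rule norm_blinfun_bound)
    show b: "0 \<le> b" using k[of 0] by (simp add: blinfun.zero_right)
    fix x
    have le: "k y \<le> b * norm y" for y
    proof (cases "y = 0")
      case False
      then have "k (inverse (norm y) *\<^sub>R y) \<le> b" by (intro k) simp
      then show ?thesis using False by (simp add: blinfun.scaleR_right field_simps)
    qed (simp add: blinfun.zero_right)
    show "norm (k x) \<le> b * norm x" using le[of x] le[of "- x"] by (auto simp: blinfun.minus_right)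
  qed
  have "norm g \<le> c - h y" if "norm y \<le> 1" for y
    using le that by (intro bound) (smt (verit))
  then have "norm h \<le> c - norm g" by (intro bound) (smt (verit))
  then show ?thesis by simp
qed

text \<open>
  This is a form of the ball intersection property of M-ideals, in which \<open>P f\<close> is almost
  preserved as well. In the bidual, \<open>z\<close> splits as a component in the biannihilator of \<open>Y\<close> and a component in the
  kernel of the adjoint of \<open>P\<close>, and the norm is the maximum of the norms of the components;
  subtracting from \<open>z + w1\<close> the first component of \<open>z\<close> leaves a vector of norm at most one, at
  which \<open>P f\<close> takes the value \<open>P f w1\<close>. The vector \<open>u\<close> in \<open>Y\<close> approximates this component.

  The proof is the corresponding separation argument in \<open>X \<times> X \<times> \<real>\<close>. If no \<open>u\<close> exists, then
  a functional \<open>(g, h, t)\<close> vanishes at all \<open>(u, u, P f u)\<close> with \<open>u\<close> in \<open>Y\<close>, takes at least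
  the value \<open>1\<close> at \<open>(z + w1, z + w2, P f z)\<close>, and satisfies \<open>norm g + norm h \<le> 1 / (1 + \<delta>)\<close>.
  The vanishing says \<open>P g + P h + t P f = 0\<close>. The value is therefore
  \<open>P g w1 + P h w2 + (g - P g) z + (h - P h) z\<close>, which the L-decomposition of the norms of
  \<open>g\<close> and \<open>h\<close> bounds by \<open>norm g + norm h < 1\<close>.
\<close>

lemma M_ideal_two_ball:
  fixes P :: "('a::real_normed_vector \<Rightarrow>\<^sub>L real) \<Rightarrow> 'a \<Rightarrow>\<^sub>L real"
  assumes Y: "subspace Y" and P: "linear P" "\<And>f. P (P f) = P f" "{f. P f = 0} = annihilator Y"
    and norm: "\<And>f. norm f = norm (P f) + norm (f - P f)"
    and w: "w1 \<in> Y" "w2 \<in> Y" "norm w1 \<le> 1" "norm w2 \<le> 1" and z: "norm z \<le> 1" and \<delta>: "\<delta> > 0"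
  obtains u where "u \<in> Y" "norm (z + w1 - u) < 1 + \<delta>" "norm (z + w2 - u) < 1 + \<delta>"
    "\<bar>P f z - P f u\<bar> < \<delta>"
proof -
  \<comment> \<open>the gauge of the set of triples that satisfy the three desired inequalities\<close>
  define N :: "'a \<times> 'a \<times> real \<Rightarrow> real"
    where "N = (\<lambda>(x, y, s). max (max (norm x / (1 + \<delta>)) (norm y / (1 + \<delta>))) (\<bar>s\<bar> / \<delta>))"
  define L where "L = (\<lambda>u. (u, u, P f u)) ` Y"
  have N: "sublinear N"
    unfolding sublinear_def
  proof (intro conjI allI impI)
    fix a b :: "'a \<times> 'a \<times> real"
    obtain x y s x' y' s' where ab: "a = (x, y, s)" "b = (x', y', s')" by (metis prod_cases3)
    have "norm (v + v') / (1 + \<delta>) \<le> norm v / (1 + \<delta>) + norm v' / (1 + \<delta>)" for v v' :: 'a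
      using \<delta> norm_triangle_ineq[of v v'] by (simp add: divide_right_mono flip: add_divide_distrib)
    from this[of x x'] this[of y y'] have
      "norm (x + x') / (1 + \<delta>) \<le> norm x / (1 + \<delta>) + norm x' / (1 + \<delta>)"
      "norm (y + y') / (1 + \<delta>) \<le> norm y / (1 + \<delta>) + norm y' / (1 + \<delta>)" .
    moreover have "\<bar>s + s'\<bar> / \<delta> \<le> \<bar>s\<bar> / \<delta> + \<bar>s'\<bar> / \<delta>"
      using \<delta> abs_triangle_ineq[of s s'] by (simp add: divide_right_mono flip: add_divide_distrib)
    ultimately show "N (a + b) \<le> N a + N b" unfolding ab N_def by (simp add: max_def)
  next
    fix r :: real and a :: "'a \<times> 'a \<times> real" assume r: "r \<ge> 0"
    obtain x y s where a: "a = (x, y, s)" by (metis prod_cases3)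
    show "N (r *\<^sub>R a) \<le> r * N a"
      unfolding a N_def using r by (simp add: abs_mult max_mult_distrib_left)
  qed
  have N_nonneg: "0 \<le> N a" for a using \<delta> by (cases a) (simp add: N_def le_max_iff_disj)
  have L: "subspace L"
    unfolding L_def using Y
    by (intro linear_subspace_image linearI) (simp_all add: blinfun.add_right blinfun.scaleR_right)
  let ?a = "(z + w1, z + w2, P f z)"
  show thesis
  proof (cases "\<exists>l\<in>L. N (?a - l) < 1")
    case True
    then obtain u where "u \<in> Y" "N (?a - (u, u, P f u)) < 1" by (auto simp: L_def)
    then show ?thesis using \<delta> by (intro that[of u]) (auto simp: N_def)
  next
    case False
    then have far: "1 \<le> N (?a - l)" if "l \<in> L" for l using that by force
    obtain F where F: "linear F" "\<And>a. F a \<le> N a" "\<And>l. l \<in> L \<Longrightarrow> F l = 0" "1 \<le> F ?a"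
      using hahn_banach_distance[OF N N_nonneg L far] by blast
    define t where "t = F (0, 0, 1)"
    have "linear (\<lambda>x :: 'a. (x, 0 :: 'a, 0 :: real))" "linear (\<lambda>x :: 'a. (0 :: 'a, x, 0 :: real))"
      by (auto intro!: linearI)
    then have lin: "linear (\<lambda>x. F (x, 0, 0))" "linear (\<lambda>x. F (0, x, 0))"
      using linear_compose[OF _ F(1)] by (auto simp: o_def)
    have bound: "F (x, 0, 0) \<le> 1 / (1 + \<delta>) * norm x" "F (0, x, 0) \<le> 1 / (1 + \<delta>) * norm x" for x
      using F(2)[of "(x, 0, 0)"] F(2)[of "(0, x, 0)"] \<delta> by (auto simp: N_def max_absorb1 max_absorb2)
    have nonneg: "0 \<le> 1 / (1 + \<delta>)" using \<delta> by simp
    obtain g :: "'a \<Rightarrow>\<^sub>L real" where g: "blinfun_apply g = (\<lambda>x. F (x, 0, 0))"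
      by (rule ex_blinfun_of_linear_le[OF lin(1) nonneg bound(1)])
    obtain h :: "'a \<Rightarrow>\<^sub>L real" where h: "blinfun_apply h = (\<lambda>x. F (0, x, 0))"
      by (rule ex_blinfun_of_linear_le[OF lin(2) nonneg bound(2)])
    have F_eq: "F (x, y, s) = g x + h y + t * s" for x y s
    proof -
      have "(x, y, s) = (x, 0, 0) + (0, y, 0) + s *\<^sub>R (0, 0, 1)" by simp
      then have "F (x, y, s) = F ((x, 0, 0) + (0, y, 0) + s *\<^sub>R (0, 0, 1))" by (rule arg_cong)
      also have "\<dots> = F (x, 0, 0) + F (0, y, 0) + s * F (0, 0, 1)"
        by (simp only: linear_add[OF F(1)] linear_scale[OF F(1)] real_scaleR_def)
      finally show ?thesis by (simp add: g h t_def)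
    qed
    have le: "norm g + norm h \<le> 1 / (1 + \<delta>)"
    proof (rule norm_add_le_if_separate_le)
      fix x y :: 'a assume xy: "norm x \<le> 1" "norm y \<le> 1"
      have "g x + h y \<le> N (x, y, 0)" using F(2)[of "(x, y, 0)"] by (simp add: F_eq)
      also have "\<dots> \<le> 1 / (1 + \<delta>)" using xy \<delta> by (simp add: N_def divide_right_mono)
      finally show "g x + h y \<le> 1 / (1 + \<delta>)" .
    qed
    have "g + h + t *\<^sub>R P f \<in> annihilator Y"
      using F(3) by (auto simp: annihilator_def L_def F_eq blinfun.add_left blinfun.scaleR_left)
    then have "P (g + h + t *\<^sub>R P f) = 0" using P(3) by blast
    then have sum0: "P g + P h + t *\<^sub>R P f = 0"
      by (simp add: linear_add[OF P(1)] linear_scale[OF P(1)] P(2))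
    have on_Y: "k y = P k y" if "y \<in> Y" for k :: "'a \<Rightarrow>\<^sub>L real" and y
    proof -
      have "P (k - P k) = 0" by (simp add: linear_diff[OF P(1)] P(2))
      then have "k - P k \<in> annihilator Y" using P(3) by blast
      then show ?thesis using that by (simp add: annihilator_def blinfun.diff_left)
    qed
    have app: "k x \<le> norm k" if "norm x \<le> 1" for k :: "'a \<Rightarrow>\<^sub>L real" and x
      using norm_blinfun[of k x] mult_left_le[OF that norm_ge_zero[of k]] by simp
    have "F ?a = P g w1 + P h w2 + (g - P g) z + (h - P h) z + (P g + P h + t *\<^sub>R P f) z"
      using on_Y[OF w(1), of g] on_Y[OF w(2), of h]
      by (simp add: F_eq blinfun.bilinear_simps)
    also have "\<dots> \<le> norm (P g) + norm (P h) + norm (g - P g) + norm (h - P h)"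
      using app[OF w(3), of "P g"] app[OF w(4), of "P h"] app[OF z, of "g - P g"] app[OF z, of "h - P h"]
      by (simp add: sum0)
    also have "\<dots> = norm g + norm h" using norm[of g] norm[of h] by simp
    finally have "1 \<le> 1 / (1 + \<delta>)" using F(4) le by linarith
    then show ?thesis using \<delta> by (simp add: field_simps)
  qed
qed

text \<open>
  Write \<open>f = P f + k\<close>, where \<open>k\<close> vanishes on \<open>Y\<close> and has norm at least \<open>1 - dual_norm_on Y f\<close>. The
  points \<open>w1\<close> and \<open>w2\<close> almost attain the norm of \<open>f\<close> on \<open>Y\<close>; some \<open>z\<close> in the unit ball almost
  attains the norm of \<open>k\<close>. For \<open>v = z - u\<close> with \<open>u\<close> from the preceding lemma the two contributions
  add up, and the norms of the sums stay close to one. The choices of \<open>w1\<close>, \<open>z\<close> and \<open>u\<close> each cost one \<open>\<delta>\<close>.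
\<close>

lemma M_ideal_lift_to_slice:
  fixes f :: "'a::real_normed_vector \<Rightarrow>\<^sub>L real"
  assumes Y: "M_ideal Y" and f: "norm f = 1" and \<delta>: "\<delta> > 0"
    and w: "w1 \<in> unit_ball_on Y" "w2 \<in> unit_ball_on Y"
    and fw: "f w1 \<ge> dual_norm_on Y f - \<delta>" "f w2 \<ge> dual_norm_on Y f - \<delta>"
  obtains v where "norm (v + w1) \<le> 1 + \<delta>" "norm (v + w2) \<le> 1 + \<delta>"
    "f (v + w1) > 1 - 3 * \<delta>" "f (v + w2) > 1 - 3 * \<delta>"
proof -
  obtain P :: "('a \<Rightarrow>\<^sub>L real) \<Rightarrow> 'a \<Rightarrow>\<^sub>L real" where sub: "subspace Y"
    and P: "linear P" "\<And>f. P (P f) = P f" "{f. P f = 0} = annihilator Y"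
    and norm: "\<And>f. norm f = norm (P f) + norm (f - P f)"
    using Y unfolding M_ideal_def by (metis bounded_linear.linear)
  define k where "k = f - P f"
  have k: "norm k \<ge> 1 - dual_norm_on Y f"
    using M_ideal_norm_le_dual_norm_on[OF sub P(1,3) norm, of f] norm[of f] f by (simp add: k_def)
  have "\<exists>z. norm z \<le> 1 \<and> k z > norm k - \<delta>"
  proof (rule ccontr)
    assume "\<not> ?thesis"
    then have "k x + (0 :: 'a \<Rightarrow>\<^sub>L real) y \<le> norm k - \<delta>" if "norm x \<le> 1" for x y using that by force
    then have "norm k + norm (0 :: 'a \<Rightarrow>\<^sub>L real) \<le> norm k - \<delta>" by (rule norm_add_le_if_separate_le)
    then show False using \<delta> by simp
  qed
  then obtain z where z: "norm z \<le> 1" "k z > norm k - \<delta>" by blast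
  obtain u where u: "u \<in> Y" "norm (z + w1 - u) < 1 + \<delta>" "norm (z + w2 - u) < 1 + \<delta>"
    "\<bar>P f z - P f u\<bar> < \<delta>"
    using M_ideal_two_ball[OF sub P norm _ _ _ _ z(1) \<delta>, of w1 w2 f] w by (auto simp: unit_ball_on_def)
  have "P k = 0" by (simp add: k_def linear_diff[OF P(1)] P(2))
  then have "k \<in> annihilator Y" using P(3) by blast
  then have "k u = 0" using u(1) by (simp add: annihilator_def)
  then have "f (z - u) = k z + (P f z - P f u)" by (simp add: k_def blinfun.bilinear_simps)
  then have "f (z - u) > 1 - dual_norm_on Y f - 2 * \<delta>" using k z(2) u(4) by linarith
  then have fv: "f (z - u + w) > 1 - 3 * \<delta>" if "f w \<ge> dual_norm_on Y f - \<delta>" for w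
    using that by (simp add: blinfun.add_right)
  have comm: "z - u + w = z + w - u" for w by simp
  have "norm (z - u + w1) \<le> 1 + \<delta>" "norm (z - u + w2) \<le> 1 + \<delta>"
    unfolding comm using u(2,3) by simp_all
  then show ?thesis using fv[OF fw(1)] fv[OF fw(2)] by (rule that)
qed

section \<open>The symmetric strong diameter two property passes from an M-ideal to the space\<close>

theorem proposition4p4:
  fixes Y :: "'a::banach set"
  assumes "subspace Y"
    and "closed Y"
    and "Y \<noteq> UNIV"
    and "Y \<noteq> {0}"
    and "M_ideal Y"
    and "SSD2P_on Y"
  shows "SSD2P_on (UNIV :: 'a set)"
  unfolding SSD2P_on_def
proof (intro allI impI)
  fix n :: nat and S :: "nat \<Rightarrow> 'a set" and \<epsilon> :: real
  assume S: "\<forall>i\<in>{1..n}. is_slice_on UNIV (S i)" and \<epsilon>: "\<epsilon> > 0"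
  have "\<exists>f :: 'a \<Rightarrow>\<^sub>L real. \<exists>\<alpha>>0. norm f = 1 \<and> S i = slice_on UNIV (blinfun_apply f) \<alpha>" if i: "i \<in> {1..n}" for i
  proof -
    obtain f \<alpha> where f: "f \<in> dual_on (UNIV :: 'a set)" "\<alpha> > 0" "dual_norm_on UNIV f = 1"
      and Si: "S i = slice_on UNIV f \<alpha>"
      using S i unfolding is_slice_on_def by blast
    have bl: "bounded_linear f" using f(1) by (simp add: dual_on_UNIV)
    have "norm (Blinfun f) = 1"
      using f(3) dual_norm_on_UNIV[OF bl] by (simp add: norm_blinfun.rep_eq bounded_linear_Blinfun_apply[OF bl])
    then show ?thesis using f(2) Si bounded_linear_Blinfun_apply[OF bl] by metis
  qed
  then obtain f :: "nat \<Rightarrow> 'a \<Rightarrow>\<^sub>L real" and \<alpha> where f: "\<And>i. i \<in> {1..n} \<Longrightarrow> norm (f i) = 1"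
    and \<alpha>: "\<And>i. i \<in> {1..n} \<Longrightarrow> \<alpha> i > 0"
    and Sf: "\<And>i. i \<in> {1..n} \<Longrightarrow> S i = slice_on UNIV (f i) (\<alpha> i)"
    by metis
  \<comment> \<open>Lifting costs \<open>3 * \<delta>\<close> and rescaling to the unit ball one more \<open>\<delta>\<close>.\<close>
  define \<delta> where "\<delta> = Min (insert \<epsilon> (\<alpha> ` {1..n})) / 4"
  have "\<delta> > 0" using \<alpha> \<epsilon> by (auto simp: \<delta>_def)
  moreover have "4 * \<delta> \<le> c" if "c \<in> insert \<epsilon> (\<alpha> ` {1..n})" for c
    unfolding \<delta>_def using Min_le[OF _ that] by simp
  ultimately have \<delta>: "\<delta> > 0" "4 * \<delta> \<le> \<epsilon>" "\<And>i. i \<in> {1..n} \<Longrightarrow> 4 * \<delta> \<le> \<alpha> i" by blast+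
  have "\<exists>T. is_slice_on Y T \<and> T \<subseteq> unit_ball_on Y \<and> (\<forall>w\<in>T. f i w \<ge> dual_norm_on Y (f i) - \<delta>)" for i
    using ex_slice_on_near_dual_norm[OF assms(1,4) blinfun_in_dual_on \<delta>(1)] by metis
  then obtain T where T: "\<And>i. is_slice_on Y (T i)" "\<And>i. T i \<subseteq> unit_ball_on Y"
    "\<And>i w. w \<in> T i \<Longrightarrow> f i w \<ge> dual_norm_on Y (f i) - \<delta>"
    by metis
  obtain x y where y: "y \<in> unit_ball_on Y" "norm y > 1 - \<delta>"
    and x: "\<And>i. i \<in> {1..n} \<Longrightarrow> x i + y \<in> T i \<and> x i - y \<in> T i"
    using assms(6) T(1) \<delta>(1) unfolding SSD2P_on_def by metis
  \<comment> \<open>The lifted points have norm at most \<open>1 + \<delta>\<close>; \<open>s\<close> brings them back into the ball.\<close>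
  define s where "s = inverse (1 + \<delta>)"
  have s: "0 < s" "s * (1 + \<delta>) = 1" using \<delta>(1) by (simp_all add: s_def)
  have scaled: "s * (1 - 3 * \<delta>) \<ge> 1 - 4 * \<delta>"
  proof -
    have "1 - 4 * \<delta> \<le> (1 - 3 * \<delta>) / (1 + \<delta>)" using \<delta>(1) by (simp add: field_simps)
    then show ?thesis by (simp add: s_def field_simps)
  qed
  have "\<exists>x'. x' \<in> S i \<and> x' + s *\<^sub>R y \<in> S i \<and> x' - s *\<^sub>R y \<in> S i" if i: "i \<in> {1..n}" for i
  proof -
    have w: "x i + y \<in> T i" "x i - y \<in> T i" using x[OF i] by auto
    obtain v where v: "norm (v + (x i + y)) \<le> 1 + \<delta>" "norm (v + (x i - y)) \<le> 1 + \<delta>"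
      "f i (v + (x i + y)) > 1 - 3 * \<delta>" "f i (v + (x i - y)) > 1 - 3 * \<delta>"
      using M_ideal_lift_to_slice[OF assms(5) f[OF i] \<delta>(1), of "x i + y" "x i - y"] w T(2,3)
      by (metis subsetD)
    have slice: "s *\<^sub>R u \<in> S i" if u: "norm u \<le> 1 + \<delta>" "f i u > 1 - 3 * \<delta>" for u
    proof -
      have "norm (s *\<^sub>R u) \<le> 1" using mult_left_mono[OF u(1), of s] s by simp
      moreover have "f i (s *\<^sub>R u) > 1 - \<alpha> i"
        using mult_strict_left_mono[OF u(2) s(1)] scaled \<delta>(3)[OF i] by (simp add: blinfun.scaleR_right)
      ultimately show ?thesis by (simp add: Sf[OF i] slice_on_def unit_ball_on_def)
    qed
    have "s *\<^sub>R (v + x i) + s *\<^sub>R y \<in> S i" "s *\<^sub>R (v + x i) - s *\<^sub>R y \<in> S i"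
      using slice[OF v(1,3)] slice[OF v(2,4)] by (simp_all add: algebra_simps)
    moreover from this have "s *\<^sub>R (v + x i) \<in> S i"
      unfolding Sf[OF i] by (rule midpoint_in_slice_on[OF subspace_UNIV blinfun_in_dual_on])
    ultimately show ?thesis by blast
  qed
  then obtain x' where x': "\<And>i. i \<in> {1..n} \<Longrightarrow> x' i \<in> S i \<and> x' i + s *\<^sub>R y \<in> S i \<and> x' i - s *\<^sub>R y \<in> S i"
    by metis
  have norm_sy: "norm (s *\<^sub>R y) = s * norm y" using s(1) by simp
  have "s \<le> 1" using \<delta>(1) by (simp add: s_def inverse_le_1_iff)
  then have "norm (s *\<^sub>R y) \<le> 1"
    unfolding norm_sy using y(1) s(1) by (intro mult_le_one) (auto simp: unit_ball_on_def)
  moreover have "norm (s *\<^sub>R y) > 1 - \<epsilon>"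
  proof -
    have "1 - \<epsilon> \<le> s * (1 - 3 * \<delta>)" using scaled \<delta>(2) by simp
    also have "\<dots> < s * norm y" using y(2) \<delta>(1) s(1) by (intro mult_strict_left_mono) auto
    finally show ?thesis by (simp only: norm_sy)
  qed
  ultimately show "\<exists>(x :: nat \<Rightarrow> 'a) y. y \<in> unit_ball_on UNIV \<and> norm y > 1 - \<epsilon> \<and>
      (\<forall>i\<in>{1..n}. x i \<in> S i \<and> x i + y \<in> S i \<and> x i - y \<in> S i)"
    using x' by (intro exI[of _ x'] exI[of _ "s *\<^sub>R y"]) (simp add: unit_ball_on_def)
qed

end
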